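(* Let $A\colon \mathbb X\to\mathbb Y$ be a bounded linear operator between separable Hilbert spaces, let $((B_\alpha)_{\alpha>0},\alpha^\star)$ be a regularization method for $Ax=y$ over $\mathbb M\subseteq\mathbb X$, and let $(D_{\theta,\beta})_{\theta,\beta}$ be the data-proximal null-space network defined by $U_\theta,V_\theta,\Phi_\beta,A$. Suppose there exist a Lipschitz function $U\colon\mathbb X\to\mathbb X$ and parameter choices $\beta^\star=\beta^\star(\delta,y^\delta)$, $\theta^\star=\theta^\star(\delta,y^\delta)$ such that $(D_{\theta,\beta})_{\theta,\beta}$ are uniformly Lipschitz on bounded sets and $$\forall z\in\mathbb M\colon\quad D_{\theta^\star,\beta^\star}(z)\to(\mathrm{Id}_{\mathbb X}+P_{\mathcal N(A)}U)(z)\quad\text{as }\delta\to0 .$$ Put $(R_\gamma)_\gamma:=(D_{\theta,\beta}\circ B_\alpha)_{\alpha,\beta,\theta}$ and $\gamma^\star:=(\alpha^\star,\beta^\star,\theta^\star)$. Let, in addition, $((B_\alpha)_{\alpha>0},\alpha^\star)$ be a rate-$r$ data proximal regularization method over $\mathbb M_s\subseteq\mathbb M$ that is convergent of rate $s$. Then, under the approximation assumption $$\|(\mathrm{Id}_{\mathbb X}+P_{\mathcal N(A)}U)(z^\star)-D_{\theta,\beta}(z^\star)\|=\mathcal O(\delta^r)\quad\text{for } z^\star\in\mathbb M_s$$ (with $\theta=\theta^\star$, $\beta=\beta^\star$), we have, for $\beta^\star=\mathcal O(\delta^r)$ and for $x^\star\in(\mathrm{Id}_{\mathbb X}+P_{\mathcal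 N(A)}U)(\mathbb M_s)$ with $\|y^\delta-Ax^\star\|\le\delta$, where $\gamma=\gamma^\star(\delta,y^\delta)$, $$\|x^\star-R_\gamma(y^\delta)\|=\mathcal O(\delta^s)\quad\text{as }\delta\to0,$$ $$\|y^\delta-A R_\gamma(y^\delta)\|=\mathcal O(\delta^r)\quad\text{as }\delta\to0 .$$ That is, the regularization method $((R_\gamma)_\gamma,\gamma^\star)$ is rate-$r$ data proximal and rate-$s$ convergent on $(\mathrm{Id}_{\mathbb X}+P_{\mathcal N(A)}U)(\mathbb M_s)$.
   Context: Notation: $\mathcal N(A)$ and $\mathcal R(A)$ are the null space and range of $A$; $P_{\mathcal N(A)}$ is the orthogonal projection onto $\mathcal N(A)$; $A^+$ is the Moore-Penrose inverse of $A$; $\mathrm{Id}_{\mathbb X}$ is the identity on $\mathbb X$; $\delta>0$ is the noise level and $y^\delta\in\mathbb Y$ denotes noisy data. Regularization method: Let $\Gamma$ be an index set, $\mathbb M\subseteq\mathbb X$, $(R_\gamma)_{\gamma\in\Gamma}$ a family of continuous (possibly non-linear) mappings $R_\gamma\colon\mathbb Y\to\mathbb X$, and $\gamma^\star\colon(0,\infty)\times\mathbb Y\to\Gamma$. The pair $((R_\gamma)_{\gamma\in\Gamma},\gamma^\star)$ is a (convergent) regularization method for $Ax=y$ over $\mathbb M$ if for all $x\in\mathbb M$, $$\lim_{\delta\to0}\Bigl(\sup\{\|x-R_{\gamma^\star(\delta,y^\delta)}(y^\delta)\| : y^\delta\in\mathbb Y,\ \|y^\delta-Ax\|\le\delta\}\Bigr)=0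 .$$ For $((B_\alpha)_{\alpha>0},\alpha^\star)$ the index set is $(0,\infty)$. Convergence of rate $s$ over a set means that for $x$ in that set and $\|y^\delta-Ax\|\le\delta$ one has $\|x-R_{\gamma^\star(\delta,y^\delta)}(y^\delta)\|=\mathcal O(\delta^s)$ as $\delta\to0$. Rate-$r$ data proximity: Let $r\in(0,1]$. A regularization method $((R_\gamma)_{\gamma\in\Gamma},\gamma^\star)$ for $Ax=y$ over $\mathbb M$ is rate-$r$ data proximal if for some $\tau>0$, for all $x\in\mathbb M$ and all $y^\delta\in\mathbb Y$: $\|y^\delta-Ax\|\le\delta$ implies $\|y^\delta-A R_{\gamma^\star(\delta,y^\delta)}(y^\delta)\|\le\tau\delta^r$. Data-proximal null-space network: Let $U_\theta,V_\theta\colon\mathbb X\to\mathbb X$ ($\theta\in\Theta$) be Lipschitz mappings, and $\Phi_\beta\colon\mathcal R(A)\to\mathcal R(A)$ ($\beta>0$) mappings with $\|\Phi_\beta(z)\|\le\beta$ for all $\beta>0$, $z\in\mathcal R(A)$. The data-proximal null-space network defined by $U_\theta,V_\theta,\Phi_\beta,A$ is the family of mappings $$D_{\theta,\beta}:=\mathrm{Id}_{\mathbb X}+P_{\mathcal N(A)}\circ U_\theta+A^+\circ\Phi_\beta\circ A\circ V_\theta .$$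
   Formalization: The rate-s error bound is proved for s ≤ r (it fails for s > r in general); rate-r data proximality is proved with one τ for all small δ, and for all δ > 0 only if β* ≤ Cδ^r holds for all δ > 0 and all data. *)

theory Defs
  imports "HOL-Analysis.Analysis" "HOL-Library.Landau_Symbols"
begin

text \<open>
  Hilbert spaces are types of sort \<open>{real_inner, banach}\<close>; separability is the library class
  \<open>second_countable_topology\<close> (for metric spaces the two notions agree).
\<close>

definition null_space :: "('x::real_vector \<Rightarrow> 'y::real_vector) \<Rightarrow> 'x set" where
  "null_space A = {x. A x = 0}"

text \<open>The library's \<open>closest_point\<close> is restricted to Heine-Borel types, i.e. finite dimension.
  For a closed subspace of a Hilbert space the \<open>p\<close> below exists and is unique.\<close>

definition orth_proj :: "'x::real_inner set \<Rightarrow> 'x \<Rightarrow> 'x" where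
  "orth_proj S x = (THE p. p \<in> S \<and> x - p \<in> S\<^sup>\<bottom>)"

text \<open>The Moore-Penrose inverse is the linear extension of the inverse of \<open>A\<close> restricted to
  \<open>(null_space A)\<^sup>\<bottom>\<close> from \<open>range A\<close> to \<open>range A + (range A)\<^sup>\<bottom>\<close> with null space \<open>(range A)\<^sup>\<bottom>\<close>:
  if \<open>y = A x + w\<close> with \<open>x \<in> (null_space A)\<^sup>\<bottom>\<close> and \<open>w \<in> (range A)\<^sup>\<bottom>\<close>, its value at \<open>y\<close> is \<open>x\<close>.
  Outside \<open>range A + (range A)\<^sup>\<bottom>\<close>, where the Moore-Penrose inverse is undefined, the value is
  arbitrary; it is only ever applied to elements of \<open>range A\<close>.\<close>

definition mp_inverse :: "('x::real_inner \<Rightarrow> 'y::real_inner) \<Rightarrow> 'y \<Rightarrow> 'x" where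
  "mp_inverse A y = (THE x. x \<in> (null_space A)\<^sup>\<bottom> \<and> y - A x \<in> (range A)\<^sup>\<bottom>)"

text \<open>Limits and Landau symbols with respect to \<open>noisy_data A x\<close>, a filter on pairs \<open>(\<delta>, y)\<close>, are
  taken as \<open>\<delta>\<close> tends to \<open>0\<close> from above and uniformly in all \<open>y\<close> with \<open>norm (y - A x) \<le> \<delta>\<close>
  (equivalently: along every choice of such data \<open>y\<close> depending on \<open>\<delta>\<close>).
  \<open>noise_to_0\<close> does not constrain \<open>y\<close> and is uniform in all \<open>y\<close>.\<close>

definition noise_to_0 :: "(real \<times> 'y) filter" where
  "noise_to_0 = filtercomap fst (at_right 0)"

definition noisy_data ::
    "('x \<Rightarrow> 'y::real_normed_vector) \<Rightarrow> 'x \<Rightarrow> (real \<times> 'y) filter" where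
  "noisy_data A x = inf noise_to_0 (principal {(\<delta>, y). norm (y - A x) \<le> \<delta>})"

text \<open>The supremum is taken in the extended nonnegative reals, so that it is \<open>\<infinity>\<close> for unbounded
  sets.\<close>

definition regularization_method ::
    "('x::real_normed_vector \<Rightarrow> 'y::real_normed_vector) \<Rightarrow> 'x set \<Rightarrow>
     'g set \<Rightarrow> ('g \<Rightarrow> 'y \<Rightarrow> 'x) \<Rightarrow> (real \<times> 'y \<Rightarrow> 'g) \<Rightarrow> bool" where
  "regularization_method A M \<Gamma> R \<gamma> \<longleftrightarrow>
     (\<forall>g\<in>\<Gamma>. continuous_on UNIV (R g)) \<and>
     \<gamma> \<in> {0<..} \<times> UNIV \<rightarrow> \<Gamma> \<and>
     (\<forall>x\<in>M. ((\<lambda>\<delta>. SUP y\<in>{y. norm (y - A x) \<le> \<delta>}. ennreal (norm (x - R (\<gamma> (\<delta>, y)) y)))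
              \<longlongrightarrow> 0) (at_right 0))"

definition convergent_of_rate ::
    "('x::real_normed_vector \<Rightarrow> 'y::real_normed_vector) \<Rightarrow> 'x set \<Rightarrow>
     ('g \<Rightarrow> 'y \<Rightarrow> 'x) \<Rightarrow> (real \<times> 'y \<Rightarrow> 'g) \<Rightarrow> real \<Rightarrow> bool" where
  "convergent_of_rate A M R \<gamma> s \<longleftrightarrow>
     (\<forall>x\<in>M. (\<lambda>(\<delta>, y). norm (x - R (\<gamma> (\<delta>, y)) y)) \<in> O[noisy_data A x](\<lambda>(\<delta>, y). \<delta> powr s))"

definition residual_bound ::
    "('x::real_normed_vector \<Rightarrow> 'y::real_normed_vector) \<Rightarrow> 'x set \<Rightarrow>
     ('g \<Rightarrow> 'y \<Rightarrow> 'x) \<Rightarrow> (real \<times> 'y \<Rightarrow> 'g) \<Rightarrow> real \<Rightarrow> real \<Rightarrow> real \<Rightarrow> bool" where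
  "residual_bound A M R \<gamma> r \<tau> \<delta> \<longleftrightarrow>
     (\<forall>x\<in>M. \<forall>y. norm (y - A x) \<le> \<delta> \<longrightarrow> norm (y - A (R (\<gamma> (\<delta>, y)) y)) \<le> \<tau> * \<delta> powr r)"

definition rate_data_proximal ::
    "('x::real_normed_vector \<Rightarrow> 'y::real_normed_vector) \<Rightarrow> 'x set \<Rightarrow>
     'g set \<Rightarrow> ('g \<Rightarrow> 'y \<Rightarrow> 'x) \<Rightarrow> (real \<times> 'y \<Rightarrow> 'g) \<Rightarrow> real \<Rightarrow> bool" where
  "rate_data_proximal A M \<Gamma> R \<gamma> r \<longleftrightarrow>
     regularization_method A M \<Gamma> R \<gamma> \<and>
     (\<exists>\<tau>>0. \<forall>\<delta>>0. residual_bound A M R \<gamma> r \<tau> \<delta>)"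

definition data_proximal_network ::
    "('x::real_inner \<Rightarrow> 'y::real_inner) \<Rightarrow> ('t \<Rightarrow> 'x \<Rightarrow> 'x) \<Rightarrow> ('t \<Rightarrow> 'x \<Rightarrow> 'x) \<Rightarrow>
     (real \<Rightarrow> 'y \<Rightarrow> 'y) \<Rightarrow> 't \<Rightarrow> real \<Rightarrow> 'x \<Rightarrow> 'x" where
  "data_proximal_network A U V \<Phi> \<theta> \<beta> x =
     x + orth_proj (null_space A) (U \<theta> x) + mp_inverse A (\<Phi> \<beta> (A (V \<theta> x)))"

definition null_space_network ::
    "('x::real_inner \<Rightarrow> 'y::real_inner) \<Rightarrow> ('x \<Rightarrow> 'x) \<Rightarrow> 'x \<Rightarrow> 'x" where
  "null_space_network A U x = x + orth_proj (null_space A) (U x)"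

definition uniformly_lipschitz_on_bounded ::
    "'i set \<Rightarrow> ('i \<Rightarrow> 'x::metric_space \<Rightarrow> 'z::metric_space) \<Rightarrow> bool" where
  "uniformly_lipschitz_on_bounded I F \<longleftrightarrow> (\<forall>S. bounded S \<longrightarrow> (\<exists>L. \<forall>i\<in>I. L-lipschitz_on S (F i)))"

end

theory Submission
  imports Defs
begin

text \<open>
  The null-space part of the network does not change \<open>A x\<close>, and \<open>A A\<^sup>+\<close> is the identity on
  \<open>range A\<close>, so \<open>A\<close> moves the network output by exactly \<open>\<Phi> \<beta> (A (V \<theta> x))\<close>, of norm at most
  \<open>\<beta>\<close>: data proximity of \<open>B\<close> survives up to the additional error \<open>\<beta> = O(\<delta> powr r)\<close>. Since also
  \<open>A (N z) = A z\<close>, data for \<open>N z\<close> are data for \<open>z\<close>, and the local uniform Lipschitz bound gives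
  \<open>norm (N z - D (B y)) \<le> norm (N z - D z) + L * norm (z - B y)\<close>.
\<close>

section \<open>Orthogonal projection onto closed subspaces of a Hilbert space\<close>

text \<open>Completeness takes the place of compactness: the sets \<open>T n\<close> of
  near-minimisers of the distance are closed, nonempty and nested, and the parallelogram law shrinks
  their diameters to 0. Their common point attains the infimum.\<close>

lemma closest_point_in_closed_convex_exists:
  fixes x :: "'a::{real_inner, banach}"
  assumes "closed S" "convex S" "S \<noteq> {}"
  shows "\<exists>p\<in>S. \<forall>z\<in>S. dist x p \<le> dist x z"
proof -
  define d where "d = infdist x S"
  have d0: "0 \<le> d" by (simp add: d_def infdist_nonneg)
  have d_le: "d \<le> dist x z" if "z \<in> S" for z
    unfolding d_def using that by (rule infdist_le)
  define T where "T n = S \<inter> {p. (dist x p)\<^sup>2 \<le> d\<^sup>2 + inverse (real (Suc n))}" for n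
  have "\<exists>p. \<forall>n. p \<in> T n"
  proof (rule decreasing_closed_nest)
    show "closed (T n)" for n
      unfolding T_def
      by (intro closed_Int assms(1) closed_Collect_le continuous_intros)
    show "T n \<noteq> {}" for n
    proof -
      have "d < sqrt (d\<^sup>2 + inverse (real (Suc n)))"
        by (rule real_less_rsqrt) simp
      moreover have "(INF z\<in>S. dist x z) = d"
        using assms(3) by (simp add: d_def infdist_def)
      ultimately have "(INF z\<in>S. dist x z) < sqrt (d\<^sup>2 + inverse (real (Suc n)))"
        by simp
      then obtain p where "p \<in> S" and p: "dist x p < sqrt (d\<^sup>2 + inverse (real (Suc n)))"
        using assms(3) by (subst (asm) cINF_less_iff) (auto intro: bdd_belowI[of _ 0])
      have "(dist x p)\<^sup>2 \<le> (sqrt (d\<^sup>2 + inverse (real (Suc n))))\<^sup>2"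
        using p by (intro power_mono) auto
      also have "\<dots> = d\<^sup>2 + inverse (real (Suc n))"
        by (subst real_sqrt_pow2) auto
      finally show ?thesis
        using \<open>p \<in> S\<close> by (auto simp: T_def)
    qed
    show "T n \<subseteq> T m" if "m \<le> n" for m n
    proof -
      have "inverse (real (Suc n)) \<le> inverse (real (Suc m))"
        using that by (intro le_imp_inverse_le) auto
      then show ?thesis
        unfolding T_def by (auto intro: order_trans)
    qed
    show "\<exists>n. \<forall>p\<in>T n. \<forall>q\<in>T n. dist p q < e" if "e > 0" for e
    proof -
      \<comment> \<open>For \<open>p\<close> and \<open>q\<close> in \<open>T n\<close> the
        parallelogram law below gives
        \<open>(dist p q)\<^sup>2 \<le> 4 * inverse (real (Suc n))\<close>, whence the factor
        4.\<close>
      obtain n where n: "inverse (real (Suc n)) < e\<^sup>2 / 4"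
        using reals_Archimedean[of "e\<^sup>2 / 4"] \<open>e > 0\<close>
        by (metis zero_less_divide_iff zero_less_numeral zero_less_power)
      have "dist p q < e" if "p \<in> T n" "q \<in> T n" for p q
      proof -
        have "midpoint p q \<in> S"
          using that assms(2) convexD[of S p q "1/2" "1/2"]
          by (auto simp: T_def midpoint_def scaleR_right_distrib)
        then have "d\<^sup>2 \<le> (dist x (midpoint p q))\<^sup>2"
          using d_le d0 by (intro power_mono)
        \<comment> \<open>Parallelogram law for the vectors \<open>x - p\<close> and
          \<open>x - q\<close>.\<close>
        moreover have "(dist p q)\<^sup>2 + 4 * (dist x (midpoint p q))\<^sup>2
            = 2 * (dist x p)\<^sup>2 + 2 * (dist x q)\<^sup>2"
          by (simp add: dist_norm midpoint_def power2_norm_eq_inner inner_diff inner_add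
              inner_commute algebra_simps)
        moreover have "(dist x p)\<^sup>2 \<le> d\<^sup>2 + inverse (real (Suc n))"
          "(dist x q)\<^sup>2 \<le> d\<^sup>2 + inverse (real (Suc n))"
          using that by (auto simp: T_def)
        ultimately have "(dist p q)\<^sup>2 < e\<^sup>2"
          using n by linarith
        then show ?thesis
          using \<open>e > 0\<close> by (simp add: power2_less_imp_less)
      qed
      then show ?thesis by blast
    qed
  qed blast
  then obtain p where p: "p \<in> S" "\<And>n. (dist x p)\<^sup>2 \<le> d\<^sup>2 + inverse (real (Suc n))"
    by (auto simp: T_def)
  have "(\<lambda>n. d\<^sup>2 + inverse (real (Suc n))) \<longlonglongrightarrow> d\<^sup>2 + 0"
    by (intro tendsto_intros LIMSEQ_inverse_real_of_nat)
  then have "(dist x p)\<^sup>2 \<le> d\<^sup>2"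
    using p(2) by (intro LIMSEQ_le_const[of _ "d\<^sup>2"]) auto
  then have "dist x p \<le> d"
    using d0 by (rule power2_le_imp_le)
  with p(1) d_le show ?thesis
    by force
qed

lemma orthogonal_decomposition_exists:
  fixes x :: "'a::{real_inner, banach}"
  assumes "closed S" "subspace S"
  shows "\<exists>p. p \<in> S \<and> x - p \<in> S\<^sup>\<bottom>"
proof -
  have cv: "convex S" and "S \<noteq> {}"
    using assms(2) by (auto intro: subspace_imp_convex subspace_0)
  then obtain p where p: "p \<in> S" "\<forall>z\<in>S. dist x p \<le> dist x z"
    using closest_point_in_closed_convex_exists[OF assms(1)] by blast
  \<comment> \<open>This is the obtuse angle criterion of the closest point \<open>p\<close>, tested
    at \<open>p + v\<close>. In a subspace \<open>- v\<close> is admissible as well, which turns the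
    inequality into orthogonality.\<close>
  have le: "inner (x - p) v \<le> 0" if "v \<in> S" for v
    using any_closest_point_dot[OF cv assms(1) p(1) subspace_add[OF assms(2) p(1) that] p(2)]
    by simp
  have "inner (x - p) v = 0" if "v \<in> S" for v
    using le[OF that] le[OF subspace_neg[OF assms(2) that]] by simp
  then show ?thesis
    using p(1) by (auto simp: orthogonal_comp_def orthogonal_def inner_commute)
qed

text \<open>The definite description needs uniqueness: the difference of two candidates lies in
  \<open>S\<close> and in \<open>S\<^sup>\<bottom>\<close>, so it is orthogonal to itself.\<close>

lemma orth_proj_in:
  fixes x :: "'a::{real_inner, banach}"
  assumes "closed S" "subspace S"
  shows "orth_proj S x \<in> S"
proof -
  have "q = p" if "p \<in> S" "x - p \<in> S\<^sup>\<bottom>" "q \<in> S" "x - q \<in> S\<^sup>\<bottom>" for p q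
  proof -
    have "(x - q) - (x - p) \<in> S\<^sup>\<bottom>"
      using that(4,2) by (rule subspace_diff[OF subspace_orthogonal_comp])
    moreover have "p - q \<in> S"
      using that assms(2) by (intro subspace_diff)
    ultimately show ?thesis
      by (auto simp: orthogonal_comp_def orthogonal_def)
  qed
  then have "\<exists>!p. p \<in> S \<and> x - p \<in> S\<^sup>\<bottom>"
    using orthogonal_decomposition_exists[OF assms, of x] by blast
  from theI'[OF this] show ?thesis
    by (simp add: orth_proj_def)
qed

section \<open>Null space and Moore-Penrose inverse\<close>

lemma closed_null_space: "bounded_linear A \<Longrightarrow> closed (null_space A)"
  unfolding null_space_def
  by (intro closed_Collect_eq continuous_intros) (auto intro: linear_continuous_on)

lemma subspace_null_space: "linear A \<Longrightarrow> subspace (null_space A)"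
  unfolding null_space_def by (rule linear_subspace_kernel)

text \<open>For \<open>w\<close> in \<open>range A\<close>, the residual \<open>w - A u\<close> lies
  in \<open>range A\<close>; being also orthogonal to it, it vanishes. What remains is to show that
  the definite description is well defined: the solution is a preimage of \<open>w\<close> stripped
  of its null space component.\<close>

lemma apply_mp_inverse:
  fixes A :: "'x::{real_inner, banach} \<Rightarrow> 'y::real_inner"
  assumes A: "bounded_linear A" and w: "w \<in> range A"
  shows "A (mp_inverse A w) = w"
proof -
  interpret bounded_linear A by (rule A)
  have sub: "subspace (null_space A)" "subspace (range A)"
    using linear_axioms by (auto intro: subspace_null_space linear_subspace_image)
  \<comment> \<open>Polymorphic, since it serves both \<open>range A\<close> and
    \<open>null_space A\<close>, which live in different spaces.\<close>
  have zero: "v = 0" if "v \<in> S" "v \<in> S\<^sup>\<bottom>" for v :: "'z::real_inner" and S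
    using that by (auto simp: orthogonal_comp_def orthogonal_def)
  have eq: "A u = w" if "w - A u \<in> (range A)\<^sup>\<bottom>" for u
    using zero[OF subspace_diff[OF sub(2) w] that] by simp
  obtain u where u: "w = A u" using w by auto
  obtain p where p: "p \<in> null_space A" "u - p \<in> (null_space A)\<^sup>\<bottom>"
    using orthogonal_decomposition_exists[OF closed_null_space[OF A] sub(1)] by blast
  have "\<exists>!u. u \<in> (null_space A)\<^sup>\<bottom> \<and> w - A u \<in> (range A)\<^sup>\<bottom>"
  proof (rule ex1I)
    show "u - p \<in> (null_space A)\<^sup>\<bottom> \<and> w - A (u - p) \<in> (range A)\<^sup>\<bottom>"
      using p by (simp add: u diff null_space_def orthogonal_comp_def orthogonal_def)
    fix v assume v: "v \<in> (null_space A)\<^sup>\<bottom> \<and> w - A v \<in> (range A)\<^sup>\<bottom>"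
    then have "v - (u - p) \<in> null_space A"
      using eq p(1) by (simp add: null_space_def diff u)
    moreover have "v - (u - p) \<in> (null_space A)\<^sup>\<bottom>"
      using conjunct1[OF v] p(2) by (rule subspace_diff[OF subspace_orthogonal_comp])
    ultimately show "v = u - p"
      using zero by fastforce
  qed
  from theI'[OF this] show ?thesis
    unfolding mp_inverse_def by (intro eq) auto
qed

lemma apply_null_space_network:
  fixes A :: "'x::{real_inner, banach} \<Rightarrow> 'y::real_inner"
  assumes "bounded_linear A"
  shows "A (null_space_network A U x) = A x"
proof -
  interpret bounded_linear A by (rule assms)
  have "orth_proj (null_space A) (U x) \<in> null_space A"
    by (intro orth_proj_in closed_null_space assms subspace_null_space linear_axioms)
  then show ?thesis
    by (simp add: null_space_network_def null_space_def add)
qed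

lemma apply_data_proximal_network:
  fixes A :: "'x::{real_inner, banach} \<Rightarrow> 'y::real_inner"
  assumes "bounded_linear A" "\<Phi> b (A (V t x)) \<in> range A"
  shows "A (data_proximal_network A U V \<Phi> t b x) = A x + \<Phi> b (A (V t x))"
proof -
  interpret bounded_linear A by (rule assms(1))
  have "orth_proj (null_space A) (U t x) \<in> null_space A"
    by (intro orth_proj_in closed_null_space assms subspace_null_space linear_axioms)
  then show ?thesis
    by (simp add: data_proximal_network_def null_space_def add apply_mp_inverse assms)
qed

section \<open>Limits along noisy data\<close>

lemma eventually_noise_to_0:
  "eventually P noise_to_0 \<longleftrightarrow> (\<forall>\<^sub>F \<delta> in at_right 0. \<forall>y. P (\<delta>, y))"
  unfolding noise_to_0_def eventually_filtercomap
proof safe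
  fix Q assume "eventually Q (at_right 0)" and "\<forall>p::real \<times> 'a. Q (fst p) \<longrightarrow> P p"
  then show "\<forall>\<^sub>F \<delta> in at_right 0. \<forall>y. P (\<delta>, y)"
    by (auto elim: eventually_mono)
next
  assume "\<forall>\<^sub>F \<delta> in at_right 0. \<forall>y. P (\<delta>, y)"
  then show "\<exists>Q. eventually Q (at_right 0) \<and> (\<forall>p. Q (fst p) \<longrightarrow> P p)"
    by (intro exI[of _ "\<lambda>\<delta>. \<forall>y. P (\<delta>, y)"]) auto
qed

lemma eventually_noisy_data:
  "eventually P (noisy_data A x) \<longleftrightarrow>
     (\<forall>\<^sub>F \<delta> in at_right 0. \<forall>y. norm (y - A x) \<le> \<delta> \<longrightarrow> P (\<delta>, y))"
  unfolding noisy_data_def eventually_inf_principal eventually_noise_to_0 by simp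

text \<open>Parameter choices are constrained to their index sets only for positive noise levels, so
  estimates along \<open>noisy_data\<close> have to carry this fact.\<close>

lemma eventually_noisy_data_pos: "\<forall>\<^sub>F p in noisy_data A x. 0 < fst p"
  unfolding eventually_noisy_data
  using eventually_at_right_less[of "0::real"] by eventually_elim simp

text \<open>Translates the worst-case error in \<open>regularization_method\<close> into an ordinary
  limit along a filter, to which the calculus of limits applies. The uniformity in \<open>y\<close>
  built into the filter is what controls the supremum.\<close>

lemma sup_error_tendsto_0_iff:
  fixes e :: "real \<times> 'y::real_normed_vector \<Rightarrow> 'z::real_normed_vector"
  shows "((\<lambda>\<delta>. SUP y\<in>{y. norm (y - A x) \<le> \<delta>}. ennreal (norm (e (\<delta>, y)))) \<longlongrightarrow> 0) (at_right 0)
     \<longleftrightarrow> (e \<longlongrightarrow> 0) (noisy_data A x)" (is "(?S \<longlongrightarrow> 0) _ \<longleftrightarrow> _")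
proof
  assume L: "(?S \<longlongrightarrow> 0) (at_right 0)"
  show "(e \<longlongrightarrow> 0) (noisy_data A x)"
  proof (rule tendstoI)
    fix c :: real assume "c > 0"
    then have "\<forall>\<^sub>F \<delta> in at_right 0. ?S \<delta> < ennreal c"
      using L by (intro order_tendstoD) auto
    then show "\<forall>\<^sub>F p in noisy_data A x. dist (e p) 0 < c"
      unfolding eventually_noisy_data
    proof eventually_elim
      case (elim \<delta>)
      show ?case
      proof (intro allI impI)
        fix y assume "norm (y - A x) \<le> \<delta>"
        then have "ennreal (norm (e (\<delta>, y))) \<le> ?S \<delta>"
          by (intro SUP_upper) auto
        also note elim
        finally show "dist (e (\<delta>, y)) 0 < c"
          by (simp add: ennreal_less_iff)
      qed
    qed
  qed
next
  assume R: "(e \<longlongrightarrow> 0) (noisy_data A x)"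
  show "(?S \<longlongrightarrow> 0) (at_right 0)"
  proof (rule order_tendstoI)
    fix a :: ennreal assume "0 < a"
    \<comment> \<open>A supremum of values below \<open>b\<close> is only bounded by
      \<open>b\<close>; the gap to \<open>a\<close> restores the strict inequality.\<close>
    then obtain b where b: "0 < b" "b < a"
      using dense by blast
    then obtain c where c: "b = ennreal c" "0 < c"
      by (cases b) auto
    have "\<forall>\<^sub>F p in noisy_data A x. dist (e p) 0 < c"
      using R c(2) by (rule tendstoD)
    then show "\<forall>\<^sub>F \<delta> in at_right 0. ?S \<delta> < a"
      unfolding eventually_noisy_data
    proof eventually_elim
      case (elim \<delta>)
      then have "?S \<delta> \<le> b"
        by (intro SUP_least) (auto simp: c intro!: ennreal_leI intro: less_imp_le)
      then show ?case using b(2) by (rule le_less_trans)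
    qed
  qed auto
qed

text \<open>Continuity is local, and every point has a bounded neighbourhood.\<close>

lemma uniformly_lipschitz_on_bounded_imp_continuous:
  fixes F :: "'i \<Rightarrow> 'x::metric_space \<Rightarrow> 'z::metric_space"
  assumes "uniformly_lipschitz_on_bounded I F" "i \<in> I"
  shows "continuous_on UNIV (F i)"
proof -
  have "continuous (at x) (F i)" for x
  proof -
    obtain L where "L-lipschitz_on (ball x 1) (F i)"
      using assms bounded_ball unfolding uniformly_lipschitz_on_bounded_def by blast
    then have "continuous_on (ball x 1) (F i)"
      by (rule lipschitz_on_continuous_on)
    then show ?thesis
      by (simp add: continuous_on_eq_continuous_at)
  qed
  then show ?thesis
    by (simp add: continuous_on_eq_continuous_at)
qed

text \<open>The error estimate has a term of order \<open>\<delta> powr r\<close> from the network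
  and one of order \<open>\<delta> powr s\<close> from \<open>B\<close>; for
  \<open>s \<le> r\<close> the former is absorbed by the latter. The Landau bound on
  \<open>\<beta>\<close> concerns small \<delta> only, whereas \<open>rate_data_proximal\<close>
  speaks of all positive \<delta>. Hence the residual bound is asserted near 0, and full data
  proximity follows from a bound on \<open>\<beta>\<close> at every noise level.\<close>

theorem theorem2p9:
  fixes A :: "'x::{real_inner, banach, second_countable_topology} \<Rightarrow>
              'y::{real_inner, banach, second_countable_topology}"
    and M M\<^sub>s :: "'x set"
    and B :: "real \<Rightarrow> 'y \<Rightarrow> 'x"
    and \<Theta> :: "'t set"
    and U\<^sub>\<Theta> V\<^sub>\<Theta> :: "'t \<Rightarrow> 'x \<Rightarrow> 'x"
    and \<Phi> :: "real \<Rightarrow> 'y \<Rightarrow> 'y"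
    and U :: "'x \<Rightarrow> 'x"
    and \<alpha> \<beta> :: "real \<times> 'y \<Rightarrow> real"
    and \<theta> :: "real \<times> 'y \<Rightarrow> 't"
    and r s :: real
    and D :: "'t \<Rightarrow> real \<Rightarrow> 'x \<Rightarrow> 'x"
    and N :: "'x \<Rightarrow> 'x"
    and \<Gamma> :: "(real \<times> real \<times> 't) set"
    and R :: "real \<times> real \<times> 't \<Rightarrow> 'y \<Rightarrow> 'x"
    and \<gamma> :: "real \<times> 'y \<Rightarrow> real \<times> real \<times> 't"
  defines "D \<equiv> data_proximal_network A U\<^sub>\<Theta> V\<^sub>\<Theta> \<Phi>"
    and "N \<equiv> null_space_network A U"
    and "\<Gamma> \<equiv> {0<..} \<times> {0<..} \<times> \<Theta>"
    and "R \<equiv> \<lambda>(a, b, t). D t b \<circ> B a"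
    and "\<gamma> \<equiv> \<lambda>p. (\<alpha> p, \<beta> p, \<theta> p)"
  assumes A: "bounded_linear A"
    and B: "regularization_method A M {0<..} B \<alpha>"
    and U_family: "\<And>t. t \<in> \<Theta> \<Longrightarrow> \<exists>L. L-lipschitz_on UNIV (U\<^sub>\<Theta> t)"
    and V_family: "\<And>t. t \<in> \<Theta> \<Longrightarrow> \<exists>L. L-lipschitz_on UNIV (V\<^sub>\<Theta> t)"
    and Phi_range: "\<And>b z. b > 0 \<Longrightarrow> z \<in> range A \<Longrightarrow> \<Phi> b z \<in> range A"
    and Phi_bound: "\<And>b z. b > 0 \<Longrightarrow> z \<in> range A \<Longrightarrow> norm (\<Phi> b z) \<le> b"
    and U: "\<exists>L. L-lipschitz_on UNIV U"
    and beta: "\<beta> \<in> {0<..} \<times> UNIV \<rightarrow> {0<..}"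
    and theta: "\<theta> \<in> {0<..} \<times> UNIV \<rightarrow> \<Theta>"
    and D_lipschitz: "uniformly_lipschitz_on_bounded (\<Theta> \<times> {0<..}) (\<lambda>(t, b). D t b)"
    and D_limit: "\<And>z. z \<in> M \<Longrightarrow> ((\<lambda>p. D (\<theta> p) (\<beta> p) z) \<longlongrightarrow> N z) (noisy_data A z)"
    and r: "0 < r" "r \<le> 1"
    and M\<^sub>s: "M\<^sub>s \<subseteq> M"
    and B_proximal: "rate_data_proximal A M\<^sub>s {0<..} B \<alpha> r"
    and B_rate: "convergent_of_rate A M\<^sub>s B \<alpha> s"
    and D_rate: "\<And>z. z \<in> M\<^sub>s \<Longrightarrow>
      (\<lambda>p. norm (N z - D (\<theta> p) (\<beta> p) z)) \<in> O[noisy_data A z](\<lambda>(\<delta>, y). \<delta> powr r)"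
    and beta_rate: "\<beta> \<in> O[noise_to_0](\<lambda>(\<delta>, y). \<delta> powr r)"
  shows "regularization_method A (N ` M\<^sub>s) \<Gamma> R \<gamma>
    \<and> (s \<le> r \<longrightarrow> convergent_of_rate A (N ` M\<^sub>s) R \<gamma> s)
    \<and> (\<forall>x\<in>N ` M\<^sub>s. (\<lambda>(\<delta>, y). norm (y - A (R (\<gamma> (\<delta>, y)) y)))
          \<in> O[noisy_data A x](\<lambda>(\<delta>, y). \<delta> powr r))
    \<and> (\<exists>\<tau>>0. \<forall>\<^sub>F \<delta> in at_right 0. residual_bound A (N ` M\<^sub>s) R \<gamma> r \<tau> \<delta>)
    \<and> ((\<exists>C. \<forall>\<delta>>0. \<forall>y. \<beta> (\<delta>, y) \<le> C * \<delta> powr r) \<longrightarrow>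
         rate_data_proximal A (N ` M\<^sub>s) \<Gamma> R \<gamma> r)"
proof -
  interpret A: bounded_linear A by (rule A)
  have AD: "norm (A (D t b x) - A x) \<le> b" if "b > 0" for t b x
    unfolding D_def using that
    by (subst apply_data_proximal_network[OF A]) (auto intro: Phi_range Phi_bound)
  have AN: "A (N x) = A x" for x
    unfolding N_def by (rule apply_null_space_network[OF A])
  have R_\<gamma>: "R (\<gamma> p) y = D (\<theta> p) (\<beta> p) (B (\<alpha> p) y)" for p y
    by (simp add: R_def \<gamma>_def)
  have beta_pos: "\<beta> (\<delta>, y) > 0" and theta_in: "\<theta> (\<delta>, y) \<in> \<Theta>" if "\<delta> > 0" for \<delta> y
    using beta theta that by auto

  \<comment> \<open>Data residuals of the composed method\<close>
  have residual: "norm (y - A (R (\<gamma> (\<delta>, y)) y)) \<le> norm (y - A (B (\<alpha> (\<delta>, y)) y)) + \<beta> (\<delta>, y)"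
    if "\<delta> > 0" for \<delta> y
    using norm_triangle_ineq4[of "y - A (B (\<alpha> (\<delta>, y)) y)"
        "A (D (\<theta> (\<delta>, y)) (\<beta> (\<delta>, y)) (B (\<alpha> (\<delta>, y)) y)) - A (B (\<alpha> (\<delta>, y)) y)"]
      AD[OF beta_pos[OF that], of "\<theta> (\<delta>, y)" y "B (\<alpha> (\<delta>, y)) y"]
    by (simp add: R_\<gamma>)
  obtain \<tau> where "\<tau> > 0" and \<tau>: "\<And>\<delta>. \<delta> > 0 \<Longrightarrow> residual_bound A M\<^sub>s B \<alpha> r \<tau> \<delta>"
    using B_proximal unfolding rate_data_proximal_def by blast
  \<comment> \<open>Stated at a single \<delta>, so that it serves both the asymptotic and the
    global bound on \<open>\<beta>\<close>.\<close>
  have residual_R: "residual_bound A (N ` M\<^sub>s) R \<gamma> r (\<tau> + C) \<delta>"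
    if "\<delta> > 0" and C: "\<forall>y. \<beta> (\<delta>, y) \<le> C * \<delta> powr r" for \<delta> C
    unfolding residual_bound_def
  proof (intro ballI allI impI)
    fix x y assume "x \<in> N ` M\<^sub>s" and "norm (y - A x) \<le> \<delta>"
    then have "norm (y - A (B (\<alpha> (\<delta>, y)) y)) \<le> \<tau> * \<delta> powr r"
      using \<tau>[OF \<open>\<delta> > 0\<close>] by (auto simp: residual_bound_def AN)
    then show "norm (y - A (R (\<gamma> (\<delta>, y)) y)) \<le> (\<tau> + C) * \<delta> powr r"
      using residual[OF \<open>\<delta> > 0\<close>, of y] C[rule_format, of y] by (simp add: distrib_right)
  qed

  obtain C where "C > 0"
    and C: "\<forall>\<^sub>F p in noise_to_0. norm (\<beta> p) \<le> C * norm (case p of (\<delta>, y) \<Rightarrow> \<delta> powr r)"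
    using beta_rate by (rule landau_o.bigE)
  from C have "\<forall>\<^sub>F \<delta> in at_right 0. residual_bound A (N ` M\<^sub>s) R \<gamma> r (\<tau> + C) \<delta>"
    unfolding eventually_noise_to_0
    by (rule eventually_elim2[OF _ eventually_at_right_less])
      (auto intro!: residual_R simp: abs_le_iff)
  then have ev_residual: "\<exists>\<tau>>0. \<forall>\<^sub>F \<delta> in at_right 0. residual_bound A (N ` M\<^sub>s) R \<gamma> r \<tau> \<delta>"
    using \<open>\<tau> > 0\<close> \<open>C > 0\<close> by (intro exI[of _ "\<tau> + C"]) auto
  then have residual_O: "(\<lambda>(\<delta>, y). norm (y - A (R (\<gamma> (\<delta>, y)) y)))
      \<in> O[noisy_data A x](\<lambda>(\<delta>, y). \<delta> powr r)" if "x \<in> N ` M\<^sub>s" for x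
  proof -
    obtain \<tau>' where "\<forall>\<^sub>F \<delta> in at_right 0. residual_bound A (N ` M\<^sub>s) R \<gamma> r \<tau>' \<delta>"
      using ev_residual by blast
    then have "\<forall>\<^sub>F p in noisy_data A x. norm (case p of (\<delta>, y) \<Rightarrow> norm (y - A (R (\<gamma> (\<delta>, y)) y)))
        \<le> \<tau>' * norm (case p of (\<delta>, y) \<Rightarrow> \<delta> powr r)"
      unfolding eventually_noisy_data
      by eventually_elim (use that in \<open>auto simp: residual_bound_def\<close>)
    then show ?thesis by (rule bigoI)
  qed

  \<comment> \<open>Error, convergence and rate of the composed method\<close>
  have B_lim: "((\<lambda>p. z - B (\<alpha> p) (snd p)) \<longlongrightarrow> 0) (noisy_data A z)" if "z \<in> M" for z
    using B that
      sup_error_tendsto_0_iff[where A = A and x = z and e = "\<lambda>p. z - B (\<alpha> p) (snd p)"]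
    by (simp add: regularization_method_def)
  have error: "\<exists>L. \<forall>\<^sub>F p in noisy_data A z.
      norm (N z - R (\<gamma> p) (snd p))
        \<le> norm (N z - D (\<theta> p) (\<beta> p) z) + L * norm (z - B (\<alpha> p) (snd p))" if "z \<in> M" for z
  proof -
    \<comment> \<open>The constant depends on \<open>z\<close> but not on the network parameters.
      One fixed ball suffices because the reconstructions by \<open>B\<close> eventually enter it,
      uniformly in the data.\<close>
    obtain L where L: "\<And>t b. t \<in> \<Theta> \<Longrightarrow> b > 0 \<Longrightarrow> L-lipschitz_on (ball z 1) (D t b)"
      using D_lipschitz[unfolded uniformly_lipschitz_on_bounded_def, rule_format, OF bounded_ball, of z 1]
      by fastforce
    have "\<forall>\<^sub>F p in noisy_data A z. dist (z - B (\<alpha> p) (snd p)) 0 < 1"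
      using B_lim[OF that] by (rule tendstoD) simp
    then have "\<forall>\<^sub>F p in noisy_data A z. norm (N z - R (\<gamma> p) (snd p))
        \<le> norm (N z - D (\<theta> p) (\<beta> p) z) + L * norm (z - B (\<alpha> p) (snd p))"
      using eventually_noisy_data_pos
    proof eventually_elim
      case (elim p)
      have "L-lipschitz_on (ball z 1) (D (\<theta> p) (\<beta> p))"
        using elim(2) theta_in beta_pos by (cases p) (auto intro: L)
      then have "dist (D (\<theta> p) (\<beta> p) z) (D (\<theta> p) (\<beta> p) (B (\<alpha> p) (snd p)))
          \<le> L * dist z (B (\<alpha> p) (snd p))"
        using elim(1) by (intro lipschitz_onD) (auto simp: dist_norm)
      then show ?case
        using dist_triangle[of "N z" "D (\<theta> p) (\<beta> p) (B (\<alpha> p) (snd p))" "D (\<theta> p) (\<beta> p) z"]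
        by (simp add: R_\<gamma> dist_norm)
    qed
    then show ?thesis ..
  qed

  have R_lim: "((\<lambda>p. N z - R (\<gamma> p) (snd p)) \<longlongrightarrow> 0) (noisy_data A z)" if "z \<in> M" for z
  proof -
    obtain L where L: "\<forall>\<^sub>F p in noisy_data A z. norm (N z - R (\<gamma> p) (snd p))
        \<le> norm (N z - D (\<theta> p) (\<beta> p) z) + L * norm (z - B (\<alpha> p) (snd p))"
      using error[OF \<open>z \<in> M\<close>] ..
    have "((\<lambda>p. norm (N z - D (\<theta> p) (\<beta> p) z) + L * norm (z - B (\<alpha> p) (snd p)))
        \<longlongrightarrow> norm (N z - N z) + L * norm (0::'x)) (noisy_data A z)"
      by (intro tendsto_intros D_limit B_lim that)
    then show ?thesis
      by (intro Lim_null_comparison[OF L]) simp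
  qed
  have regularization: "regularization_method A (N ` M\<^sub>s) \<Gamma> R \<gamma>"
    unfolding regularization_method_def
  proof (intro conjI ballI)
    fix g assume g: "g \<in> \<Gamma>"
    obtain a b t where [simp]: "g = (a, b, t)" by (cases g)
    have "continuous_on UNIV (B a)"
      using g B by (simp add: \<Gamma>_def regularization_method_def)
    moreover have "continuous_on UNIV (D t b)"
      using uniformly_lipschitz_on_bounded_imp_continuous[OF D_lipschitz, of "(t, b)"] g
      by (simp add: \<Gamma>_def)
    ultimately show "continuous_on UNIV (R g)"
      by (simp add: R_def continuous_on_compose2[where t = UNIV] comp_def)
  next
    show "\<gamma> \<in> {0<..} \<times> UNIV \<rightarrow> \<Gamma>"
      using B beta theta by (auto simp: \<gamma>_def \<Gamma>_def regularization_method_def Pi_iff)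
  next
    fix x assume "x \<in> N ` M\<^sub>s"
    then obtain z where [simp]: "x = N z" and "z \<in> M" using M\<^sub>s by auto
    show "((\<lambda>\<delta>. SUP y\<in>{y. norm (y - A x) \<le> \<delta>}. ennreal (norm (x - R (\<gamma> (\<delta>, y)) y))) \<longlongrightarrow> 0)
        (at_right 0)"
      using R_lim[OF \<open>z \<in> M\<close>]
        sup_error_tendsto_0_iff[where A = A and x = z and e = "\<lambda>p. N z - R (\<gamma> p) (snd p)"]
      by (simp add: AN)
  qed

  have rate: "convergent_of_rate A (N ` M\<^sub>s) R \<gamma> s" if "s \<le> r"
    unfolding convergent_of_rate_def
  proof
    fix x assume "x \<in> N ` M\<^sub>s"
    then obtain z where [simp]: "x = N z" and z: "z \<in> M\<^sub>s" by auto
    let ?F = "noisy_data A z"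
    \<comment> \<open>For \<delta> between 0 and 1, powers decrease as the exponent grows.\<close>
    have "\<forall>\<^sub>F \<delta> in at_right 0. \<delta> powr r \<le> (\<delta> powr s :: real)"
      using eventually_at_right_real[OF zero_less_one]
      by eventually_elim (auto intro: powr_mono' that)
    then have "\<forall>\<^sub>F p in ?F. norm (case p of (\<delta>, y) \<Rightarrow> \<delta> powr r)
        \<le> 1 * norm (case p of (\<delta>, y) \<Rightarrow> \<delta> powr s)"
      unfolding eventually_noisy_data by eventually_elim simp
    then have rs: "(\<lambda>(\<delta>, y). \<delta> powr r) \<in> O[?F](\<lambda>(\<delta>, y). \<delta> powr s)"
      by (rule bigoI)
    obtain L where "\<forall>\<^sub>F p in ?F. norm (N z - R (\<gamma> p) (snd p))
        \<le> norm (N z - D (\<theta> p) (\<beta> p) z) + L * norm (z - B (\<alpha> p) (snd p))"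
      using error z M\<^sub>s by blast
    then have "(\<lambda>p. norm (N z - R (\<gamma> p) (snd p)))
        \<in> O[?F](\<lambda>p. norm (N z - D (\<theta> p) (\<beta> p) z) + L * norm (z - B (\<alpha> p) (snd p)))"
      by (intro bigoI[of _ 1]) (auto elim: eventually_mono)
    also have "(\<lambda>p. norm (N z - D (\<theta> p) (\<beta> p) z) + L * norm (z - B (\<alpha> p) (snd p)))
        \<in> O[?F](\<lambda>(\<delta>, y). \<delta> powr s)"
    proof (rule sum_in_bigo)
      show "(\<lambda>p. norm (N z - D (\<theta> p) (\<beta> p) z)) \<in> O[?F](\<lambda>(\<delta>, y). \<delta> powr s)"
        using D_rate[OF z] rs by (rule landau_o.big_trans)
      have "(\<lambda>p. norm (z - B (\<alpha> p) (snd p))) \<in> O[?F](\<lambda>(\<delta>, y). \<delta> powr s)"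
        using B_rate z by (auto simp: convergent_of_rate_def case_prod_unfold)
      then show "(\<lambda>p. L * norm (z - B (\<alpha> p) (snd p))) \<in> O[?F](\<lambda>(\<delta>, y). \<delta> powr s)"
        \<comment> \<open>A nonzero constant factor cancels inside the Landau symbol; for
          \<open>L = 0\<close> the function is zero.\<close>
        by (cases "L = 0") simp_all
    qed
    \<comment> \<open>The filter \<open>noisy_data A x\<close> depends on \<open>x\<close> only
      through \<open>A x\<close>, so by \<open>AN\<close> it coincides with the one at
      \<open>z\<close>.\<close>
    finally show "(\<lambda>(\<delta>, y). norm (x - R (\<gamma> (\<delta>, y)) y)) \<in> O[noisy_data A x](\<lambda>(\<delta>, y). \<delta> powr s)"
      by (simp add: case_prod_unfold noisy_data_def AN)
  qed

  have proximal: "rate_data_proximal A (N ` M\<^sub>s) \<Gamma> R \<gamma> r"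
    if bound: "\<exists>C. \<forall>\<delta>>0. \<forall>y. \<beta> (\<delta>, y) \<le> C * \<delta> powr r"
  proof -
    obtain C where C: "\<And>\<delta> y. \<delta> > 0 \<Longrightarrow> \<beta> (\<delta>, y) \<le> C * \<delta> powr r"
      using bound by blast
    \<comment> \<open>At \<delta> = 1 the power is 1, so \<open>C\<close> dominates a positive value
      of \<open>\<beta>\<close>; this makes \<open>\<tau> + C\<close> an admissible
      constant.\<close>
    have "C > 0"
      using C[of 1 0] beta_pos[of 1 0] by simp
    then show ?thesis
      unfolding rate_data_proximal_def
      using regularization residual_R C \<open>\<tau> > 0\<close>
      by (intro conjI exI[of _ "\<tau> + C"]) auto
  qed

  show ?thesis
    using regularization rate residual_O ev_residual proximal by blast
qed

end
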